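(* Let $k=p^{\alpha}$ with $p$ a prime and $\alpha$ a positive integer. Let $A$ be a finite subset of $\mathbb{Z}$ with $|A|\geq (k-1)^{2}\,k!$. Then $$|A+k\cdot A|\geq (k+1)|A|-\lceil k(k+2)/4\rceil .$$
   Context: For a finite set $A\subseteq\mathbb{Z}$ and a positive integer $k$, $k\cdot A=\{ka: a\in A\}$ is the dilate of $A$ by $k$, and $A+k\cdot A=\{a+kb: a,b\in A\}$. *)

theory Defs
  imports Complex_Main "HOL-Computational_Algebra.Primes" "HOL-Library.Set_Algebras"
begin

end

theory Submission
  imports Defs "HOL-Number_Theory.Cong"
begin

text \<open>
  Split \<open>A\<close> into its residue classes mod \<open>k\<close>, and for each residue \<open>u\<close> of \<open>A\<close> let
  \<open>X u = {x. u + k * x \<in> A}\<close> be its fiber. Residues mod \<open>k\<close> separate the parts of \<open>A + k *o A\<close>, so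
  that its size is the sum of the sizes of \<open>X u + A\<close> (\<open>card_dilate_sumset\<close>). Let \<open>j\<close> be the number of
  classes. Dilating and translating, one may assume that not all elements of \<open>A\<close> agree mod \<open>p\<close>
  (\<open>normalise_mod\<close>). The bound proved is \<open>(k + 1) * card A - j * (k + 1 - j)\<close>; the maximum of the
  defect over integers \<open>j\<close> is the constant in the theorem (\<open>class_defect_le_ceiling\<close>).

  A fiber is called full if it meets all classes mod \<open>k\<close>. For a full fiber,
  \<open>card (X u + A) \<ge> card (X u) + k * (n - 1)\<close>, where \<open>n\<close> is the size of a largest fiber. If all
  fibers are full, the sum of these bounds falls short of the claim by at most \<open>j * (j - 1)\<close>, and the
  missing elements come from the minima of the classes of \<open>A\<close> (\<open>dilate_bound_all_full\<close>).

  If \<open>X u\<close> is not full, compare \<open>X u + A\<close> with its subset \<open>u + X u + k *o X u\<close>, a sum of a set and its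
  own dilate. As \<open>k\<close> is a power of \<open>p\<close>, the translations that preserve the residues of \<open>X u\<close> mod \<open>k\<close>
  are the multiples of some \<open>p ^ \<beta>\<close> with \<open>\<beta> \<ge> 1\<close>. Hence every class \<open>l\<close> of \<open>A\<close> with \<open>l - u\<close> not
  divisible by \<open>p ^ \<beta>\<close> puts copies of \<open>X l\<close> into residue classes that the subset does not meet
  (\<open>sumset_gain_not_full\<close>). Balancing these gains against the fiber sizes shows that a bound of slope
  \<open>m \<le> k\<close>, valid for all finite sets, implies one of slope \<open>m + 1\<close> with a worse constant
  (\<open>dilate_bound_step\<close>). Induction yields slope \<open>k + 1\<close> with the constant \<open>fact k\<close>
  (\<open>dilate_bound_weak\<close>).

  One more application of the same gains, now on top of slope \<open>k + 1\<close>, shows that a single fiber that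
  is not full makes the sumset larger by the size of the largest fiber (\<open>dilate_bound_not_full\<close>). For
  \<open>card A \<ge> (k - 1)^2 * fact k\<close> and \<open>j < k\<close> this covers all constants lost. In the remaining case
  \<open>j = k\<close> the bound is immediate (\<open>card_dilate_sumset_ge\<close>).
\<close>

section \<open>Residue classes and fibers\<close>

definition classes :: "int \<Rightarrow> int set \<Rightarrow> int set"
  where "classes k A = (\<lambda>a. a mod k) ` A"

definition fiber :: "int \<Rightarrow> int set \<Rightarrow> int \<Rightarrow> int set"
  where "fiber k A u = {x. u + k * x \<in> A}"

text \<open>The next two notions depend only on the image of \<open>X\<close> in \<open>\<int>/k\<int>\<close>. They are stated for integers
  because the same \<open>X\<close> is also considered modulo divisors \<open>q\<close> of \<open>k\<close>.\<close>
definition full :: "int \<Rightarrow> int set \<Rightarrow> bool"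
  where "full k X \<longleftrightarrow> (\<forall>r. \<exists>x\<in>X. [x = r] (mod k))"

definition shift_closed :: "int \<Rightarrow> int set \<Rightarrow> int \<Rightarrow> bool"
  where "shift_closed k X d \<longleftrightarrow> (\<forall>x\<in>X. \<exists>x'\<in>X. [x' = x + d] (mod k))"

lemma dilate_eq_image: "c *o (B :: int set) = (*) c ` B"
  by (auto simp: elt_set_times_def)

lemma finite_dilate [simp]: "finite B \<Longrightarrow> finite (c *o (B :: int set))"
  by (simp add: dilate_eq_image)

text \<open>The chain \<open>S + min T\<close> followed by \<open>max S + T\<close> increases strictly through \<open>S + T\<close>; its two
  halves share only the element \<open>max S + min T\<close>.\<close>
lemma card_sumset_ge:
  fixes S T :: "int set"
  assumes "finite S" "finite T" "S \<noteq> {}" "T \<noteq> {}"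
  shows "card S + card T \<le> card (S + T) + 1"
proof -
  let ?P = "(\<lambda>s. s + Min T) ` S" and ?Q = "(\<lambda>t. Max S + t) ` T"
  have sub: "?P \<union> ?Q \<subseteq> S + T"
    using assms by (intro Un_least image_subsetI set_plus_intro) auto
  have "x = Max S + Min T" if "x \<in> ?P \<inter> ?Q" for x
  proof -
    from that obtain s t where "s \<in> S" "t \<in> T" "x = s + Min T" "x = Max S + t" by auto
    moreover have "s \<le> Max S" "Min T \<le> t" using assms calculation by auto
    ultimately show ?thesis by linarith
  qed
  then have "?P \<inter> ?Q \<subseteq> {Max S + Min T}" by blast
  then have "card (?P \<inter> ?Q) \<le> 1"
    using card_mono[of "{Max S + Min T}"] by simp
  moreover have "card (?P \<union> ?Q) \<le> card (S + T)"
    using sub assms by (intro card_mono finite_set_plus)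
  moreover have "card ?P = card S" "card ?Q = card T"
    by (auto intro!: card_image inj_onI)
  moreover have "card ?P + card ?Q = card (?P \<union> ?Q) + card (?P \<inter> ?Q)"
    using assms by (intro card_Un_Int) auto
  ultimately show ?thesis by linarith
qed

lemma finite_classes [simp]: "finite A \<Longrightarrow> finite (classes k A)"
  by (simp add: classes_def)

lemma finite_fiber [simp]:
  assumes "finite A" "k > 0" shows "finite (fiber k A u)"
proof -
  have "fiber k A u = (\<lambda>x. u + k * x) -` A" by (auto simp: fiber_def)
  then show ?thesis using assms by (auto intro!: finite_vimageI inj_onI)
qed

lemma classesD: "u \<in> classes k A \<Longrightarrow> k > 0 \<Longrightarrow> 0 \<le> u \<and> u < k"
  by (auto simp: classes_def)

lemma fiber_nonempty:
  assumes "u \<in> classes k A" "k > 0" shows "fiber k A u \<noteq> {}"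
proof -
  from assms obtain a where "a \<in> A" "u = a mod k" by (auto simp: classes_def)
  then have "a div k \<in> fiber k A u" by (simp add: fiber_def)
  then show ?thesis by blast
qed

lemma classes_cong_eq:
  "u \<in> classes k A \<Longrightarrow> v \<in> classes k A \<Longrightarrow> [u = v] (mod k) \<Longrightarrow> u = v"
  by (auto simp: classes_def cong_def)

text \<open>Adding multiples of \<open>k\<close> does not change residues mod \<open>k\<close>, so the part of \<open>A + k *o B\<close> in the
  class of \<open>u\<close> comes from the elements \<open>u + k * x\<close> of \<open>A\<close>, and it is the image of
  \<open>fiber k A u + B\<close> under \<open>z \<mapsto> u + k * z\<close>. This turns the problem into one about the sumsets
  \<open>fiber k A u + A\<close>.\<close>
lemma card_dilate_sumset:
  assumes "finite A" "finite B" "k > 0"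
  shows "card (A + k *o B) = (\<Sum>u\<in>classes k A. card (fiber k A u + B))"
proof -
  let ?piece = "\<lambda>u. (\<lambda>x. u + k * x) ` (fiber k A u + B)"
  have *: "\<exists>u\<in>classes k A. z \<in> ?piece u" if z: "z \<in> A + k *o B" for z
  proof -
    from z obtain a b where ab: "a \<in> A" "b \<in> B" "z = a + k * b"
      by (auto simp: set_plus_def elt_set_times_def)
    have "z = a mod k + k * (a div k + b)" using ab by (simp add: algebra_simps)
    moreover have "a div k \<in> fiber k A (a mod k)" using ab by (simp add: fiber_def)
    ultimately show ?thesis using ab unfolding classes_def by (auto simp: set_plus_def)
  qed
  have **: "u + k * z \<in> A + k *o B" if "z \<in> fiber k A u + B" for u z
  proof -
    from that obtain x b where "u + k * x \<in> A" "b \<in> B" "z = x + b"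
      by (auto simp: set_plus_def fiber_def)
    then have "u + k * z = (u + k * x) + k * b" by (simp add: algebra_simps)
    also have "\<dots> \<in> A + k *o B"
      using \<open>u + k * x \<in> A\<close> \<open>b \<in> B\<close> by (intro set_plus_intro) (auto simp: elt_set_times_def)
    finally show ?thesis .
  qed
  have "A + k *o B = (\<Union>u\<in>classes k A. ?piece u)"
    using * ** by blast
  also have "card \<dots> = (\<Sum>u\<in>classes k A. card (?piece u))"
  proof (rule card_UN_disjoint)
    show "\<forall>i\<in>classes k A. \<forall>j\<in>classes k A. i \<noteq> j \<longrightarrow> ?piece i \<inter> ?piece j = {}"
    proof (intro ballI impI)
      fix i j assume ij: "i \<in> classes k A" "j \<in> classes k A" "i \<noteq> j"
      have "(i + k * x) mod k = i" "(j + k * x) mod k = j" for x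
        using classesD[OF ij(1) assms(3)] classesD[OF ij(2) assms(3)] by auto
      with ij(3) show "?piece i \<inter> ?piece j = {}" by (smt (verit) disjoint_iff imageE)
    qed
  qed (use assms in \<open>auto intro!: finite_set_plus\<close>)
  also have "\<dots> = (\<Sum>u\<in>classes k A. card (fiber k A u + B))"
    using assms by (intro sum.cong refl card_image inj_onI) auto
  finally show ?thesis .
qed

lemma card_eq_sum_fibers:
  assumes "finite A" "k > 0"
  shows "card A = (\<Sum>u\<in>classes k A. card (fiber k A u))"
  using card_dilate_sumset[of A "{0}" k] assms by (simp add: dilate_eq_image)

text \<open>Each residue class of \<open>A\<close> contributes one sumset, hence one gain of \<open>card B - 1\<close>. With
  \<open>B = A\<close> and \<open>k\<close> classes this is already a bound of slope \<open>k + 1\<close>.\<close>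
lemma card_dilate_sumset_ge:
  assumes "finite A" "finite B" "B \<noteq> {}" "k > 0"
  shows "int (card (A + k *o B)) \<ge> int (card A) + int (card (classes k A)) * (int (card B) - 1)"
proof -
  have "int (card A) + int (card (classes k A)) * (int (card B) - 1)
      = (\<Sum>u\<in>classes k A. int (card (fiber k A u)) + (int (card B) - 1))"
    by (simp add: card_eq_sum_fibers[OF assms(1,4)] sum.distrib)
  also have "\<dots> \<le> (\<Sum>u\<in>classes k A. int (card (fiber k A u + B)))"
  proof (rule sum_mono)
    fix u assume "u \<in> classes k A"
    then show "int (card (fiber k A u)) + (int (card B) - 1) \<le> int (card (fiber k A u + B))"
      using card_sumset_ge[of "fiber k A u" B] assms fiber_nonempty by force
  qed
  finally show ?thesis by (simp add: card_dilate_sumset assms)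
qed

lemma full_card_classes:
  assumes "full k X" "k > 0" shows "card (classes k X) = nat k"
proof -
  have "classes k X = {0..<k}"
  proof
    show "classes k X \<subseteq> {0..<k}" using assms(2) by (auto simp: classes_def)
    show "{0..<k} \<subseteq> classes k X"
    proof
      fix r assume r: "r \<in> {0..<k}"
      from assms obtain x where "x \<in> X" "[x = r] (mod k)" by (auto simp: full_def)
      with r show "r \<in> classes k X" by (force simp: classes_def cong_def)
    qed
  qed
  then show ?thesis by simp
qed

text \<open>The elements of \<open>A\<close> congruent to \<open>l\<close> embed a translate of \<open>X + k *o fiber k A l\<close> into \<open>X + A\<close>.
  For \<open>X = fiber k A l\<close> this is a sum of a set with its own dilate, to which an inductive
  hypothesis applies.\<close>
lemma translated_fiber_sumset_subset:
  "(+) l ` (X + k *o fiber k A l) \<subseteq> X + A"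
proof
  fix z assume "z \<in> (+) l ` (X + k *o fiber k A l)"
  then obtain x y where xy: "x \<in> X" "l + k * y \<in> A" "z = l + (x + k * y)"
    by (auto simp: set_plus_def elt_set_times_def fiber_def)
  then have "z = x + (l + k * y)" by simp
  with xy show "z \<in> X + A" by (metis set_plus_intro)
qed

text \<open>The class \<open>l\<close> on the right is arbitrary. Taking it to be the largest one gives a full fiber \<open>X\<close>
  a surplus of \<open>k\<close> times the amount by which \<open>X\<close> falls short of the largest fiber.\<close>
lemma full_sumset_ge:
  assumes "full k X" "finite X" "finite A" "k > 0" "l \<in> classes k A"
  shows "int (card (X + A)) \<ge> int (card X) + k * (int (card (fiber k A l)) - 1)"
proof -
  have "int (card X) + k * (int (card (fiber k A l)) - 1) \<le> int (card (X + k *o fiber k A l))"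
    using card_dilate_sumset_ge[of X "fiber k A l" k] assms
    by (simp add: full_card_classes fiber_nonempty)
  also have "card (X + k *o fiber k A l) = card ((+) l ` (X + k *o fiber k A l))"
    by (simp add: card_image)
  also have "\<dots> \<le> card (X + A)"
    using assms by (intro card_mono translated_fiber_sumset_subset finite_set_plus)
  finally show ?thesis by simp
qed

section \<open>Lower bounds from disjoint residue classes\<close>

text \<open>For \<open>y \<in> X\<close>, the translate by \<open>y\<close> of the class \<open>l\<close> of \<open>A\<close> is a copy of \<open>fiber k A l\<close> inside
  \<open>X + A\<close>, all in the residue class of \<open>y + l\<close>. Copies in distinct classes are disjoint. A base set
  \<open>Z\<close> that avoids these classes can be counted as well.\<close>
lemma card_sumset_ge_pieces:
  assumes fin: "finite X" "finite A" "finite I" and "k > 0"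
    and Z: "Z \<subseteq> X + A" "\<And>t z. t \<in> I \<Longrightarrow> z \<in> Z \<Longrightarrow> \<not> [z = f t + g t] (mod k)"
    and fX: "\<And>t. t \<in> I \<Longrightarrow> f t \<in> X"
    and inj: "\<And>s t. s \<in> I \<Longrightarrow> t \<in> I \<Longrightarrow> [f s + g s = f t + g t] (mod k) \<Longrightarrow> s = t"
  shows "card Z + (\<Sum>t\<in>I. card (fiber k A (g t))) \<le> card (X + A)"
proof -
  let ?W = "\<lambda>t. (\<lambda>x. f t + (g t + k * x)) ` fiber k A (g t)"
  have W: "[z = f t + g t] (mod k)" if "z \<in> ?W t" for z t
    using that by (auto simp: cong_iff_dvd_diff)
  have "finite (X + A)" using fin by (simp add: finite_set_plus)
  then have finZ: "finite Z" using Z finite_subset by blast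
  have sub: "(\<Union>t\<in>I. ?W t) \<subseteq> X + A"
    using fX by (auto simp: fiber_def)
  have "card (\<Union>t\<in>I. ?W t) = (\<Sum>t\<in>I. card (?W t))"
  proof (rule card_UN_disjoint)
    show "\<forall>i\<in>I. \<forall>j\<in>I. i \<noteq> j \<longrightarrow> ?W i \<inter> ?W j = {}"
    proof (intro ballI impI)
      fix i j assume ij: "i \<in> I" "j \<in> I" "i \<noteq> j"
      have "[f i + g i = f j + g j] (mod k)" if "z \<in> ?W i" "z \<in> ?W j" for z
        using W[OF that(1)] W[OF that(2)] cong_sym cong_trans by blast
      then show "?W i \<inter> ?W j = {}" using inj ij by blast
    qed
  qed (use assms in auto)
  also have "\<dots> = (\<Sum>t\<in>I. card (fiber k A (g t)))"
    using \<open>k > 0\<close> by (intro sum.cong refl card_image inj_onI) auto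
  finally have c: "card (\<Union>t\<in>I. ?W t) = (\<Sum>t\<in>I. card (fiber k A (g t)))" .
  have "Z \<inter> (\<Union>t\<in>I. ?W t) = {}" using Z(2) W by blast
  then have "card Z + (\<Sum>t\<in>I. card (fiber k A (g t))) = card (Z \<union> (\<Union>t\<in>I. ?W t))"
    using c finZ fin \<open>k > 0\<close> by (subst card_Un_disjoint) auto
  also have "\<dots> \<le> card (X + A)"
    using sub Z(1) \<open>finite (X + A)\<close> by (intro card_mono) auto
  finally show ?thesis .
qed

lemma card_sumset_ge_base_pieces:
  assumes fin: "finite X" "finite A" "finite I" and "k > 0"
    and new: "\<And>t x. t \<in> I \<Longrightarrow> x \<in> X \<Longrightarrow> \<not> [x + i = f t + g t] (mod k)"
    and fX: "\<And>t. t \<in> I \<Longrightarrow> f t \<in> X"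
    and inj: "\<And>s t. s \<in> I \<Longrightarrow> t \<in> I \<Longrightarrow> [f s + g s = f t + g t] (mod k) \<Longrightarrow> s = t"
  shows "card (X + k *o fiber k A i) + (\<Sum>t\<in>I. card (fiber k A (g t))) \<le> card (X + A)"
proof -
  let ?Z = "(+) i ` (X + k *o fiber k A i)"
  have "\<not> [z = f t + g t] (mod k)" if "t \<in> I" "z \<in> ?Z" for z t
  proof -
    from that(2) obtain x y where "x \<in> X" "z = i + (x + k * y)"
      by (auto simp: set_plus_def elt_set_times_def)
    then have "[z = x + i] (mod k)" by (simp add: cong_iff_dvd_diff)
    then show ?thesis using new[OF that(1) \<open>x \<in> X\<close>] cong_sym cong_trans by blast
  qed
  then have "card ?Z + (\<Sum>t\<in>I. card (fiber k A (g t))) \<le> card (X + A)"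
    using assms translated_fiber_sumset_subset by (intro card_sumset_ge_pieces[where f = f]) auto
  then show ?thesis by (simp add: card_image)
qed

section \<open>Periods of a set of residues\<close>

lemma shift_closed_cong:
  assumes "shift_closed k X d" "[d = d'] (mod k)" shows "shift_closed k X d'"
  using assms unfolding shift_closed_def by (meson cong_add_lcancel cong_trans)

lemma shift_closed_mult:
  assumes "shift_closed k X d" shows "shift_closed k X (int n * d)"
proof (induction n)
  case 0
  show ?case unfolding shift_closed_def by (auto intro: cong_refl)
next
  case (Suc n)
  show ?case
    unfolding shift_closed_def
  proof
    fix x assume "x \<in> X"
    then obtain y where y: "y \<in> X" "[y = x + int n * d] (mod k)"
      using Suc.IH by (auto simp: shift_closed_def)
    then obtain z where "z \<in> X" "[z = y + d] (mod k)"
      using assms by (auto simp: shift_closed_def)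
    moreover have "[y + d = x + int (Suc n) * d] (mod k)"
      using cong_add[OF y(2) cong_refl[of d]] by (simp add: algebra_simps)
    ultimately show "\<exists>z\<in>X. [z = x + int (Suc n) * d] (mod k)"
      using cong_trans by blast
  qed
qed

text \<open>By Bezout, \<open>gcd d k\<close> is mod \<open>k\<close> a nonnegative multiple of \<open>d\<close>.\<close>
lemma shift_closed_gcd:
  assumes "shift_closed k X d" "k > 0" shows "shift_closed k X (gcd d k)"
proof -
  obtain u v where uv: "u * d + v * k = gcd d k" using bezout_int by blast
  have "u * d + v * k - (u - k * (u div k)) * d = k * (v + (u div k) * d)"
    by (simp add: algebra_simps)
  then have "k dvd gcd d k - (u mod k) * d"
    unfolding uv minus_mult_div_eq_mod by simp
  then have "[int (nat (u mod k)) * d = gcd d k] (mod k)"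
    using \<open>k > 0\<close> by (simp add: cong_iff_dvd_diff dvd_diff_commute)
  then show ?thesis using shift_closed_mult[OF assms(1)] shift_closed_cong by blast
qed

lemma full_if_shift_closed_1:
  assumes "shift_closed k X 1" "X \<noteq> {}" "k > 0" shows "full k X"
  unfolding full_def
proof
  fix r
  obtain x where "x \<in> X" using assms by blast
  moreover have "shift_closed k X (int (nat ((r - x) mod k)) * 1)"
    by (rule shift_closed_mult) fact
  then have "shift_closed k X (r - x)"
    by (rule shift_closed_cong) (use assms in \<open>simp add: cong_def\<close>)
  ultimately show "\<exists>x\<in>X. [x = r] (mod k)"
    by (force simp: shift_closed_def)
qed

text \<open>Here the prime power enters: the subgroups of \<open>\<int>/k\<int>\<close> form a chain, so the stabilizer of a set
  of residues is generated by one power of \<open>p\<close>, and it is proper exactly when this power is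
  divisible by \<open>p\<close>.\<close>
lemma exists_minimal_period:
  fixes p \<alpha> :: nat
  assumes "prime p" "k = int p ^ \<alpha>" "X \<noteq> {}" "\<not> full k X"
  obtains \<beta> where "1 \<le> \<beta>" "\<beta> \<le> \<alpha>" "shift_closed k X (int p ^ \<beta>)"
    "\<And>d. \<not> int p ^ \<beta> dvd d \<Longrightarrow> \<not> shift_closed k X d"
proof -
  have "k > 0" using assms by (simp add: prime_gt_0_nat)
  define \<beta> where "\<beta> = (LEAST \<beta>. shift_closed k X (int p ^ \<beta>))"
  have top: "shift_closed k X (int p ^ \<alpha>)"
    using assms(2) by (auto simp: shift_closed_def cong_def)
  have \<beta>: "shift_closed k X (int p ^ \<beta>)" "\<beta> \<le> \<alpha>"
    unfolding \<beta>_def using LeastI[of "\<lambda>\<beta>. shift_closed k X (int p ^ \<beta>)", OF top] Least_le[of "\<lambda>\<beta>. shift_closed k X (int p ^ \<beta>)", OF top] by auto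
  have "\<beta> \<noteq> 0"
    using \<beta>(1) full_if_shift_closed_1[of k X] assms \<open>k > 0\<close> by (cases "\<beta> = 0") auto
  moreover have "\<not> shift_closed k X d" if d: "\<not> int p ^ \<beta> dvd d" for d
  proof
    assume "shift_closed k X d"
    then have g: "shift_closed k X (gcd d k)" using \<open>k > 0\<close> by (rule shift_closed_gcd)
    have "prime (int p)" using assms(1) by simp
    moreover have "gcd d k dvd int p ^ \<alpha>" using assms(2) by simp
    ultimately obtain \<gamma> where \<gamma>: "gcd d k = int p ^ \<gamma>"
      by (metis divides_primepow normalize_gcd)
    have "\<beta> \<le> \<gamma>" using g \<gamma> unfolding \<beta>_def by (simp add: Least_le)
    then have "int p ^ \<beta> dvd gcd d k" by (simp add: \<gamma> le_imp_power_dvd)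
    then show False using d by (meson dvd_trans gcd_dvd1)
  qed
  ultimately show ?thesis using that[of \<beta>] \<beta> by auto
qed

section \<open>Gains of a fiber that is not full\<close>

text \<open>Let \<open>p ^ \<beta>\<close> be the minimal period of \<open>X\<close> mod \<open>k\<close>. Translating the residues of \<open>X\<close> by
  \<open>l - i\<close>, which is not a period, leads outside of them, and then outside of them along a whole
  coset of the stabilizer. So the class \<open>l\<close> of \<open>A\<close> contributes to \<open>X + A\<close> in \<open>p ^ (\<alpha> - \<beta>)\<close> residue
  classes that contain nothing of \<open>i + X + k *o fiber k A i\<close>. The multiplicity \<open>p ^ (\<alpha> - \<beta>)\<close> is
  what later compensates for a small class \<open>l\<close>.\<close>

lemma sumset_gain_not_full:
  fixes p \<alpha> :: nat
  assumes "prime p" "k = int p ^ \<alpha>" "X \<noteq> {}" "\<not> full k X" "finite X" "finite A"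
  obtains \<beta> where "1 \<le> \<beta>" "\<beta> \<le> \<alpha>"
    "\<And>i l. \<not> [l = i] (mod (int p ^ \<beta>)) \<Longrightarrow>
       card (X + k *o fiber k A i) + p ^ (\<alpha> - \<beta>) * card (fiber k A l) \<le> card (X + A)"
proof -
  have "k > 0" "int p > 0" using assms by (simp_all add: prime_gt_0_nat)
  obtain \<beta> where \<beta>: "1 \<le> \<beta>" "\<beta> \<le> \<alpha>" "shift_closed k X (int p ^ \<beta>)"
    "\<And>d. \<not> int p ^ \<beta> dvd d \<Longrightarrow> \<not> shift_closed k X d"
    using exists_minimal_period[OF assms(1-4)] by blast
  define q h where "q = int p ^ \<beta>" and "h = p ^ (\<alpha> - \<beta>)"
  have k: "k = int h * q"
    using \<beta>(2) by (simp add: assms(2) q_def h_def flip: power_add)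
  have "q > 0" using \<open>int p > 0\<close> by (simp add: q_def)
  have "card (X + k *o fiber k A i) + h * card (fiber k A l) \<le> card (X + A)"
    if il: "\<not> [l = i] (mod q)" for i l
  proof -
    have "\<not> q dvd (l - i)" using il by (simp add: cong_iff_dvd_diff)
    then have "\<not> shift_closed k X (l - i)"
      using \<beta>(4) q_def by blast
    then obtain y where y: "y \<in> X" "\<And>x. x \<in> X \<Longrightarrow> \<not> [x = y + (l - i)] (mod k)"
      by (auto simp: shift_closed_def)
    have "\<forall>t. \<exists>x\<in>X. [x = y + int t * q] (mod k)"
      using shift_closed_mult[OF \<beta>(3)] y(1) by (simp add: shift_closed_def q_def)
    then obtain f where f: "\<And>t. f t \<in> X" "\<And>t. [f t = y + int t * q] (mod k)"
      by metis
    have "card (X + k *o fiber k A i) + (\<Sum>t\<in>{..<h}. card (fiber k A l)) \<le> card (X + A)"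
    proof (rule card_sumset_ge_base_pieces[where f = f])
      fix t x assume t: "t \<in> {..<h}" and x: "x \<in> X"
      show "\<not> [x + i = f t + l] (mod k)"
      proof
        assume "[x + i = f t + l] (mod k)"
        \<comment> \<open>Going on by \<open>h - t\<close> periods completes the multiple \<open>h * q = k\<close> and returns to \<open>y + (l - i)\<close>.\<close>
        obtain x' where x': "x' \<in> X" "[x' = x + int (h - t) * q] (mod k)"
          using shift_closed_mult[OF \<beta>(3)] x by (auto simp: shift_closed_def q_def)
        have "k dvd (x' - (x + int (h - t) * q)) + (x + i - (f t + l)) + (f t - (y + int t * q)) + k"
          using x'(2) \<open>[x + i = f t + l] (mod k)\<close> f(2)[of t]
          by (intro dvd_add) (simp_all add: cong_iff_dvd_diff)
        also have "\<dots> = x' - (y + (l - i))"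
          using t by (simp add: k of_nat_diff algebra_simps)
        finally show False using y(2)[OF x'(1)] by (simp add: cong_iff_dvd_diff)
      qed
    next
      fix s t assume st: "s \<in> {..<h}" "t \<in> {..<h}" "[f s + l = f t + l] (mod k)"
      then have "[f s = f t] (mod k)" by (simp add: cong_add_rcancel)
      then have "[y + int s * q = y + int t * q] (mod k)"
        using f(2) cong_sym cong_trans by meson
      then have "int h * q dvd (int s - int t) * q"
        by (simp add: cong_iff_dvd_diff k algebra_simps)
      then have "int h dvd int s - int t" using \<open>q > 0\<close> by simp
      then show "s = t"
        using st(1,2) by (metis cong_iff_dvd_diff cong_int_iff cong_less_modulus_unique_nat lessThan_iff)
    qed (use assms \<open>k > 0\<close> f in auto)
    then show ?thesis by simp
  qed
  then show ?thesis using that[of \<beta>] \<beta> by (simp add: q_def h_def)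
qed

text \<open>If \<open>X\<close> misses a class mod \<open>q\<close>, then translating by the unit \<open>w - v\<close> leads some \<open>y \<in> X\<close> outside
  of the classes mod \<open>q\<close> of \<open>X\<close>. All \<open>u \<in> B\<close> agree with \<open>w\<close> mod \<open>q\<close>, so that the same \<open>y\<close> serves
  for every one of them: all of \<open>B\<close> is gained at once.\<close>
lemma sumset_gain_escape:
  assumes "coprime (w - v) q" "q > 0" "q dvd k" "k > 0" "\<not> full q X" "X \<noteq> {}"
    and "finite X" "finite A" "B \<subseteq> classes k A" "\<And>u. u \<in> B \<Longrightarrow> [u = w] (mod q)"
  shows "card (X + k *o fiber k A v) + (\<Sum>u\<in>B. card (fiber k A u)) \<le> card (X + A)"
proof -
  have "\<not> shift_closed q X (w - v)"
    using shift_closed_gcd[of q X "w - v"] full_if_shift_closed_1[of q X] assms by auto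
  then obtain y where y: "y \<in> X" "\<And>x. x \<in> X \<Longrightarrow> \<not> [x = y + (w - v)] (mod q)"
    by (auto simp: shift_closed_def)
  show ?thesis
  proof (rule card_sumset_ge_base_pieces[where f = "\<lambda>_. y"])
    show "finite B" using assms finite_subset finite_classes by blast
    fix u x assume u: "u \<in> B" and x: "x \<in> X"
    show "\<not> [x + v = y + u] (mod k)"
    proof
      assume "[x + v = y + u] (mod k)"
      then have "q dvd (x + v - (y + u)) + (u - w)"
        using assms(3) assms(10)[OF u] by (intro dvd_add) (auto simp: cong_iff_dvd_diff intro: dvd_trans)
      also have "\<dots> = x - (y + (w - v))" by simp
      finally show False using y(2)[OF x] by (simp add: cong_iff_dvd_diff)
    qed
  next
    fix s t assume "s \<in> B" "t \<in> B" "[y + s = y + t] (mod k)"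
    then show "s = t"
      using assms(9) classes_cong_eq[of s k A t] by (auto simp: cong_add_lcancel)
  qed (use assms y in auto)
qed

text \<open>If on the other hand \<open>X\<close> meets all classes mod \<open>q\<close>, then one element of each already places \<open>q\<close>
  disjoint copies of the part of \<open>A\<close> over \<open>B\<close> in \<open>X + A\<close>.\<close>
lemma sumset_ge_full_translates:
  assumes "full q X" "q > 0" "q dvd k" "k > 0"
    and "finite X" "finite A" "B \<subseteq> classes k A" "\<And>u. u \<in> B \<Longrightarrow> [u = w] (mod q)"
  shows "q * int (\<Sum>u\<in>B. card (fiber k A u)) \<le> int (card (X + A))"
proof -
  from assms(1) obtain f where f: "\<And>r. f r \<in> X" "\<And>r. [f r = r] (mod q)"
    unfolding full_def by metis
  let ?I = "{0..<q} \<times> B"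
  have "card ({} :: int set) + (\<Sum>t\<in>?I. card (fiber k A (snd t))) \<le> card (X + A)"
  proof (rule card_sumset_ge_pieces[where f = "\<lambda>t. f (fst t)"])
    show "finite ?I" using assms finite_subset finite_classes by blast
    fix s t assume s: "s \<in> ?I" and t: "t \<in> ?I" and st: "[f (fst s) + snd s = f (fst t) + snd t] (mod k)"
    have "[f (fst z) + snd z = fst z + w] (mod q)" if "z \<in> ?I" for z
      using that f(2) assms(8) by (intro cong_add) auto
    moreover have "[f (fst s) + snd s = f (fst t) + snd t] (mod q)"
      using st assms(3) cong_dvd_modulus by blast
    ultimately have "[fst s + w = fst t + w] (mod q)"
      using s t cong_sym cong_trans by meson
    then have "[fst s = fst t] (mod q)" by (simp add: cong_add_rcancel)
    then have fst: "fst s = fst t" using s t by (auto simp: cong_def)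
    then have "[snd s = snd t] (mod k)" using st by (simp add: cong_add_lcancel)
    then have "snd s = snd t"
      using s t assms(7) classes_cong_eq[of "snd s" k A "snd t"] by (auto simp: mem_Times_iff dest: subsetD)
    with fst show "s = t" by (simp add: prod_eq_iff)
  qed (use assms f in auto)
  moreover have "(\<Sum>t\<in>?I. card (fiber k A (snd t))) = nat q * (\<Sum>u\<in>B. card (fiber k A u))"
    using sum.cartesian_product[of "\<lambda>_ u. card (fiber k A u)" B "{0..<q}"]
    by (simp add: case_prod_beta)
  ultimately have "nat q * (\<Sum>u\<in>B. card (fiber k A u)) \<le> card (X + A)" by simp
  then have "int (nat q * (\<Sum>u\<in>B. card (fiber k A u))) \<le> int (card (X + A))"
    by (rule of_nat_mono)
  then show ?thesis using assms(2) by simp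
qed

lemma card_classes_le:
  assumes "k > 0" shows "int (card (classes k A)) \<le> k"
proof -
  have "classes k A \<subseteq> {0..<k}" using assms by (auto simp: classes_def)
  then have "card (classes k A) \<le> card {0..<k}" by (intro card_mono) auto
  then show ?thesis using assms by simp
qed

section \<open>A bound of slope \<open>k + 1\<close> with a large constant\<close>

lemma incongruent_class:
  assumes "a \<in> A" "b \<in> A" "\<not> [a = b] (mod q)" "q dvd k"
  obtains v where "v \<in> classes k A" "\<not> [v = w] (mod q)"
proof -
  have "\<exists>c\<in>A. \<not> [c = w] (mod q)"
    using assms(1-3) cong_sym cong_trans by blast
  then obtain c where c: "c \<in> A" "\<not> [c = w] (mod q)" by blast
  have "[c mod k = c] (mod q)" using assms(4) by (simp add: cong_def mod_mod_cancel)
  then have "\<not> [c mod k = w] (mod q)" using c(2) cong_sym cong_trans by blast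
  then show ?thesis using that[of "c mod k"] c(1) by (auto simp: classes_def)
qed

lemma largest_fiber:
  assumes "finite A" "A \<noteq> {}"
  obtains w where "w \<in> classes k A" "\<And>u. u \<in> classes k A \<Longrightarrow> card (fiber k A u) \<le> card (fiber k A w)"
proof -
  let ?c = "\<lambda>u. card (fiber k A u)"
  have "Max (?c ` classes k A) \<in> ?c ` classes k A"
    using assms by (intro Max_in) (auto simp: classes_def)
  then obtain w where w: "w \<in> classes k A" "?c w = Max (?c ` classes k A)" by auto
  then show ?thesis using that[of w] assms by auto
qed

text \<open>The base set \<open>X + k *o X\<close> of a fiber \<open>X\<close> is itself a sum with a dilate. So a bound valid for all
  finite sets applies to it, and the new residue classes are gained on top of that bound.\<close>
lemma fiber_gain_not_full:
  fixes p \<alpha> :: nat and m C :: int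
  assumes p: "prime p" "k = int p ^ \<alpha>" and A: "finite A"
    and bound: "\<And>X. finite X \<Longrightarrow> X \<noteq> {} \<Longrightarrow> int (card (X + k *o X)) \<ge> m * int (card X) - C"
    and u: "u \<in> classes k A" "\<not> full k (fiber k A u)"
  obtains \<beta> where "1 \<le> \<beta>" "\<beta> \<le> \<alpha>"
    "\<And>l. \<not> [l = u] (mod (int p ^ \<beta>)) \<Longrightarrow>
       int (card (fiber k A u + A))
         \<ge> m * int (card (fiber k A u)) - C + int p ^ (\<alpha> - \<beta>) * int (card (fiber k A l))"
proof -
  let ?X = "fiber k A u"
  have "k > 0" using p by (simp add: prime_gt_0_nat)
  then have X: "finite ?X" "?X \<noteq> {}" using A u(1) by (simp_all add: fiber_nonempty)
  obtain \<beta> where \<beta>: "1 \<le> \<beta>" "\<beta> \<le> \<alpha>"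
    "\<And>i l. \<not> [l = i] (mod (int p ^ \<beta>)) \<Longrightarrow>
       card (?X + k *o fiber k A i) + p ^ (\<alpha> - \<beta>) * card (fiber k A l) \<le> card (?X + A)"
    using sumset_gain_not_full[OF p X(2) u(2) X(1) A] by blast
  have "int (card (?X + A)) \<ge> m * int (card ?X) - C + int p ^ (\<alpha> - \<beta>) * int (card (fiber k A l))"
    if "\<not> [l = u] (mod (int p ^ \<beta>))" for l
  proof -
    have "int (card (?X + k *o ?X) + p ^ (\<alpha> - \<beta>) * card (fiber k A l)) \<le> int (card (?X + A))"
      using \<beta>(3)[OF that] by (rule of_nat_mono)
    then show ?thesis using bound[OF X] by simp
  qed
  with \<beta>(1,2) show ?thesis using that by blast
qed

text \<open>From slope \<open>m\<close> to slope \<open>m + 1\<close>. Write \<open>x u\<close> for the size of the fiber \<open>X u\<close> and \<open>g u\<close> for what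
  \<open>X u + A\<close> has beyond slope \<open>m\<close>; the claim is that the sum of all \<open>g u\<close> is at least the sum of all
  \<open>x u\<close>. Let \<open>w\<close> be a largest class. A full fiber has \<open>g u \<ge> x u\<close> with surplus \<open>k * (x w - x u)\<close>,
  and a fiber that is not full has \<open>g u \<ge> x w\<close>, unless \<open>w - u\<close> is a period of it. The latter classes
  form the set \<open>B\<close>; it may contain \<open>w\<close> itself and other large classes.

  The classes in \<open>B\<close> are congruent to \<open>w\<close> mod \<open>p\<close>. They are paid for by one class \<open>v\<close> incongruent to
  \<open>w\<close> mod \<open>p\<close>; for \<open>u \<in> B\<close>, the difference \<open>v - u\<close> is prime to \<open>p\<close> and so not a period of \<open>X u\<close>.
  If \<open>X v\<close> is full, its surplus covers the difference between \<open>x v\<close> and the at most \<open>k\<close> members of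
  \<open>B\<close>. Otherwise take \<open>c \<in> B\<close> with the smallest minimal period \<open>q\<close>, and \<open>k = q * h\<close>. Then \<open>B\<close> lies
  in one class mod \<open>q\<close>, and \<open>c\<close> gains \<open>h * x v\<close>. Let \<open>S\<close> be the sum of \<open>x u\<close> over \<open>B\<close>. If \<open>X v\<close> misses
  a class mod \<open>q\<close>, it gains \<open>S\<close> by \<open>sumset_gain_escape\<close>. If not, \<open>X v + A\<close> has at least \<open>q * S\<close>
  elements by \<open>sumset_ge_full_translates\<close>, which is enough because
  \<open>(q - 1) * S + h * x v \<ge> k * x v\<close> as soon as \<open>S \<ge> h * x v\<close>.\<close>
lemma dilate_bound_step:
  fixes p \<alpha> :: nat and m C L :: int
  assumes p: "prime p" "k = int p ^ \<alpha>" "\<alpha> > 0" and A: "finite A"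
    and ab: "a \<in> A" "b \<in> A" "\<not> [a = b] (mod (int p))"
    and bound: "\<And>X. finite X \<Longrightarrow> X \<noteq> {} \<Longrightarrow> int (card (X + k *o X)) \<ge> m * int (card X) - C"
    and m: "0 \<le> m" "m \<le> k" and L: "C \<le> L" "m \<le> L"
  shows "int (card (A + k *o A)) \<ge> (m + 1) * int (card A) - int (card (classes k A)) * L"
proof -
  have "k > 0" "int p > 0" using p by (simp_all add: prime_gt_0_nat)
  have pk: "int p dvd k" using p by (simp add: dvd_power)
  define U where "U = classes k A"
  define X where "X = fiber k A"
  define x where "x = (\<lambda>u. int (card (X u)))"
  define g where "g = (\<lambda>u. int (card (X u + A)) - (m * x u - L))"
  define E where "E = {u \<in> U. \<not> full k (X u)}"
  have finX: "finite (X u)" for u using A \<open>k > 0\<close> by (simp add: X_def)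
  have neX: "X u \<noteq> {}" if "u \<in> U" for u using that \<open>k > 0\<close> by (simp add: X_def U_def fiber_nonempty)
  have pos: "x u \<ge> 1" if "u \<in> U" for u
    using neX[OF that] finX[of u] card_gt_0_iff[of "X u"] by (simp add: x_def)
  have x0: "x u \<ge> 0" for u by (simp add: x_def)
  have finU: "finite U" using A by (simp add: U_def)
  obtain w where w: "w \<in> U" "\<And>u. u \<in> U \<Longrightarrow> x u \<le> x w"
    using largest_fiber[of A k] A ab(1) unfolding U_def x_def X_def
    by (metis empty_iff of_nat_le_iff)
  obtain v where v: "v \<in> U" "\<not> [v = w] (mod int p)"
    using incongruent_class[OF ab pk] unfolding U_def by blast

  have F: "g u \<ge> x u + k * (x w - x u)" if u: "u \<in> U" "u \<notin> E" for u
  proof -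
    have "int (card (X u + A)) \<ge> x u + k * (x w - 1)"
      using full_sumset_ge[of k "X u" A w] u w finX A \<open>k > 0\<close>
      by (simp add: x_def X_def E_def U_def)
    moreover have "(k - m) * (x u - 1) \<ge> 0" using m(2) pos[OF u(1)] by simp
    ultimately show ?thesis using L(2) unfolding g_def by (simp add: algebra_simps)
  qed
  have "\<forall>u\<in>E. \<exists>\<beta>. 1 \<le> \<beta> \<and> \<beta> \<le> \<alpha> \<and> (\<forall>l. \<not> [l = u] (mod (int p ^ \<beta>)) \<longrightarrow>
       g u \<ge> int p ^ (\<alpha> - \<beta>) * x l)"
  proof
    fix u assume "u \<in> E"
    then have u: "u \<in> U" "\<not> full k (X u)" by (auto simp: E_def)
    obtain \<beta> where \<beta>: "1 \<le> \<beta>" "\<beta> \<le> \<alpha>"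
      "\<And>l. \<not> [l = u] (mod (int p ^ \<beta>)) \<Longrightarrow>
         int (card (X u + A)) \<ge> m * x u - C + int p ^ (\<alpha> - \<beta>) * x l"
      using fiber_gain_not_full[OF p(1,2) A bound, of u] u unfolding X_def U_def x_def by blast
    have "g u \<ge> int p ^ (\<alpha> - \<beta>) * x l" if "\<not> [l = u] (mod (int p ^ \<beta>))" for l
      using \<beta>(3)[OF that] L(1) unfolding g_def by linarith
    with \<beta> show "\<exists>\<beta>. 1 \<le> \<beta> \<and> \<beta> \<le> \<alpha> \<and> (\<forall>l. \<not> [l = u] (mod (int p ^ \<beta>)) \<longrightarrow>
       g u \<ge> int p ^ (\<alpha> - \<beta>) * x l)" by blast
  qed
  then obtain \<beta> where \<beta>: "\<And>u. u \<in> E \<Longrightarrow> 1 \<le> \<beta> u" "\<And>u. u \<in> E \<Longrightarrow> \<beta> u \<le> \<alpha>"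
    and gain: "\<And>u l. u \<in> E \<Longrightarrow> \<not> [l = u] (mod (int p ^ \<beta> u)) \<Longrightarrow> g u \<ge> int p ^ (\<alpha> - \<beta> u) * x l"
    by metis
  have gain1: "g u \<ge> x l" if "u \<in> E" "\<not> [l = u] (mod (int p ^ \<beta> u))" for u l
  proof -
    have "1 * x l \<le> int p ^ (\<alpha> - \<beta> u) * x l"
      using \<open>int p > 0\<close> x0 by (intro mult_right_mono) (auto simp: one_le_power)
    then show ?thesis using gain[OF that] by simp
  qed
  have cong_p: "[l = u] (mod (int p))" if "[l = u] (mod (int p ^ \<beta> u))" "u \<in> E" for u l
    using that \<beta>(1)[of u] by (intro cong_dvd_modulus[OF that(1)]) (simp add: dvd_power)

  define B where "B = {u \<in> E. [w = u] (mod (int p ^ \<beta> u))}"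
  have BU: "B \<subseteq> E" "B \<subseteq> U" "finite B" using finU by (auto simp: B_def E_def)
  have vB: "v \<notin> B" using cong_p v(2) by (auto simp: B_def intro: cong_sym)
  have good: "g u \<ge> x u" if "u \<in> U" "u \<notin> B" for u
  proof (cases "u \<in> E")
    case True
    then show ?thesis using gain1[of u w] that w(2)[of u] by (auto simp: B_def)
  next
    case False
    have "k * (x w - x u) \<ge> 0" using \<open>k > 0\<close> w(2)[OF that(1)] by simp
    then show ?thesis using F[OF that(1) False] by linarith
  qed
  \<comment> \<open>The class \<open>v\<close> is treated together with \<open>B\<close>; every other class stands on its own.\<close>
  have key: "g v + (\<Sum>u\<in>B. g u) \<ge> x v + (\<Sum>u\<in>B. x u)" if Bne: "B \<noteq> {}"
  proof -
    have vgain: "\<not> [v = u] (mod (int p ^ \<beta> u))" if "u \<in> B" for u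
      using that v(2) cong_p[of v u] cong_p[of w u] cong_sym cong_trans unfolding B_def by blast
    have gB: "g u \<ge> x v" if "u \<in> B" for u
      using gain1[of u v] vgain that BU by blast
    show ?thesis
    proof (cases "v \<in> E")
      case False
      have "(\<Sum>u\<in>B. x u - g u) \<le> (\<Sum>u\<in>B. x w - x v)"
        using gB w(2) BU by (intro sum_mono) (smt (verit) subsetD)
      also have "\<dots> = int (card B) * (x w - x v)" by simp
      also have "\<dots> \<le> k * (x w - x v)"
      proof (rule mult_right_mono)
        have "card B \<le> card U" using BU finU by (intro card_mono)
        then show "int (card B) \<le> k" using card_classes_le[OF \<open>k > 0\<close>, of A] by (simp add: U_def)
      qed (use w(2)[OF v(1)] in simp)
      finally show ?thesis using F[OF v(1) False] by (simp add: sum_subtractf)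
    next
      case True
      have gv: "g v \<ge> x w"
        using gain1[OF True, of w] cong_p[of w v] v(2) True by (meson cong_sym)
      obtain c where c: "c \<in> B" "\<And>u. u \<in> B \<Longrightarrow> \<beta> c \<le> \<beta> u"
        using arg_min_if_finite(1)[OF BU(3) Bne, of \<beta>] arg_min_least[OF BU(3) Bne, of _ \<beta>] by blast
      define q h where "q = int p ^ \<beta> c" and "h = int p ^ (\<alpha> - \<beta> c)"
      have kqh: "k = q * h"
        using \<beta>(2) c(1) BU by (auto simp: p(2) q_def h_def simp flip: power_add)
      have "q > 0" "h > 0" using \<open>int p > 0\<close> by (simp_all add: q_def h_def)
      have Bq: "[u = w] (mod q)" if "u \<in> B" for u
      proof (rule cong_dvd_modulus)
        show "[u = w] (mod (int p ^ \<beta> u))" using that by (auto simp: B_def cong_sym)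
        show "q dvd int p ^ \<beta> u" using c(2)[OF that] by (simp add: q_def le_imp_power_dvd)
      qed
      have gc: "g c \<ge> h * x v" using gain[of c v] vgain c(1) BU unfolding h_def by blast
      define S where "S = (\<Sum>u\<in>B. x u)"
      have S: "S = int (\<Sum>u\<in>B. card (fiber k A u))" by (simp add: S_def x_def X_def)
      have split: "(\<Sum>u\<in>B. g u) = g c + (\<Sum>u\<in>B - {c}. g u)"
        using c(1) BU(3) by (simp add: sum.remove)
      have hv: "h * x v \<ge> x v" using mult_right_mono[of 1 h "x v"] \<open>h > 0\<close> x0 by simp
      show ?thesis
      \<comment> \<open>For a single bad class, \<open>v\<close> and \<open>c\<close> pay for each other. Otherwise a second bad class gains
        \<open>x v\<close>, and this covers \<open>v\<close> itself.\<close>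
      proof (cases "B = {c}")
        case True
        then show ?thesis using gv gc hv w(2)[of c] BU c(1) by auto
      next
        case False
        then obtain d where d: "d \<in> B - {c}" using c(1) by blast
        have "x v \<le> g d" using gB d by blast
        also have "\<dots> \<le> (\<Sum>u\<in>B - {c}. g u)"
          using d BU(3) gB x0 by (intro member_le_sum) (auto intro: order_trans)
        finally have gsum: "(\<Sum>u\<in>B. g u) \<ge> h * x v + x v" using split gc by linarith
        have "g v + h * x v \<ge> S"
        proof (cases "full q (X v)")
          case True
          show ?thesis
          proof (cases "S \<le> h * x v")
            case True
            then show ?thesis using gv x0[of w] by linarith
          next
            case False
            have "q * S \<le> int (card (X v + A))"
              unfolding S
              by (rule sumset_ge_full_translates[where w = w])
                (use True \<open>q > 0\<close> \<open>k > 0\<close> kqh finX A BU(2) Bq in \<open>auto simp: U_def\<close>)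
            moreover have "(q - 1) * S \<ge> (q - 1) * (h * x v)"
              using False \<open>q > 0\<close> by (intro mult_left_mono) auto
            moreover have "k * x v \<ge> m * x v" using m(2) x0 by (intro mult_right_mono) auto
            ultimately show ?thesis unfolding g_def kqh using L m(1) by (simp add: algebra_simps)
          qed
        next
          case False
          have "\<not> int p dvd (w - v)" using v(2) by (simp add: cong_iff_dvd_diff dvd_diff_commute)
          then have "coprime (int p) (w - v)" using p(1) by (intro prime_imp_coprime) auto
          then have "coprime (w - v) q" by (simp add: q_def coprime_commute)
          then have "card (X v + k *o fiber k A v) + (\<Sum>u\<in>B. card (fiber k A u)) \<le> card (X v + A)"
            by (rule sumset_gain_escape)
              (use False \<open>q > 0\<close> \<open>k > 0\<close> kqh finX A BU(2) Bq neX[OF v(1)] in \<open>auto simp: U_def\<close>)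
          then have "int (card (X v + k *o X v)) + S \<le> int (card (X v + A))"
            unfolding S X_def by linarith
          then have "g v \<ge> S" using bound[OF finX neX[OF v(1)]] L(1) by (simp add: g_def x_def)
          then show ?thesis using hv x0[of v] by linarith
        qed
        then show ?thesis using gsum unfolding S_def by linarith
      qed
    qed
  qed
  have "(\<Sum>u\<in>U. g u) \<ge> (\<Sum>u\<in>U. x u)"
  proof (cases "B = {}")
    case True
    then show ?thesis using good by (intro sum_mono) auto
  next
    case False
    let ?V = "insert v B"
    have V: "?V \<subseteq> U" "finite ?V" using v BU by auto
    have "(\<Sum>u\<in>U - ?V. g u) \<ge> (\<Sum>u\<in>U - ?V. x u)" using good by (intro sum_mono) auto
    moreover have "(\<Sum>u\<in>?V. g u) \<ge> (\<Sum>u\<in>?V. x u)" using key[OF False] vB BU by simp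
    ultimately show ?thesis
      using sum.subset_diff[OF V(1) finU, of g] sum.subset_diff[OF V(1) finU, of x] by linarith
  qed
  moreover have "(\<Sum>u\<in>U. x u) = int (card A)"
    using card_eq_sum_fibers[OF A \<open>k > 0\<close>] by (simp add: U_def x_def X_def)
  moreover have "(\<Sum>u\<in>U. g u) = int (card (A + k *o A)) - m * (\<Sum>u\<in>U. x u) + int (card U) * L"
    using card_dilate_sumset[OF A A \<open>k > 0\<close>]
    by (simp add: g_def U_def X_def sum_subtractf sum.distrib sum_distrib_left)
  ultimately show ?thesis by (simp add: U_def algebra_simps)
qed

lemma card_dilate_sumset_affine:
  fixes k c d :: int
  assumes "d \<noteq> 0"
  shows "card ((\<lambda>z. c + d * z) ` A + k *o ((\<lambda>z. c + d * z) ` A)) = card (A + k *o A)"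
proof -
  have "(\<lambda>z. c + d * z) ` A + k *o ((\<lambda>z. c + d * z) ` A) = (\<lambda>z. c + k * c + d * z) ` (A + k *o A)"
    (is "?S = ?T")
  proof
    show "?S \<subseteq> ?T"
    proof
      fix y assume "y \<in> ?S"
      then obtain a b where ab: "a \<in> A" "b \<in> A" "y = (c + d * a) + k * (c + d * b)"
        by (auto simp: set_plus_def elt_set_times_def)
      then have "y = c + k * c + d * (a + k * b)" by (simp add: algebra_simps)
      moreover have "a + k * b \<in> A + k *o A"
        using ab by (intro set_plus_intro) (auto simp: elt_set_times_def)
      ultimately show "y \<in> ?T" by blast
    qed
    show "?T \<subseteq> ?S"
    proof
      fix y assume "y \<in> ?T"
      then obtain a b where ab: "a \<in> A" "b \<in> A" "y = c + k * c + d * (a + k * b)"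
        by (auto simp: set_plus_def elt_set_times_def)
      then have "y = (c + d * a) + k * (c + d * b)" by (simp add: algebra_simps)
      also have "\<dots> \<in> ?S"
        using ab by (intro set_plus_intro) (auto simp: elt_set_times_def)
      finally show "y \<in> ?S" .
    qed
  qed
  then show ?thesis using assms by (simp add: card_image inj_on_def)
qed

text \<open>If all elements of \<open>A\<close> agree mod \<open>q\<close>, then \<open>A = x + q *o A'\<close>, and passing to \<open>A'\<close> divides the
  distance between two chosen elements by \<open>q\<close>; this stops.\<close>
lemma normalise_mod:
  fixes q k :: int
  assumes "q > 1" "finite A" "x \<in> A" "y \<in> A" "x \<noteq> y"
  obtains A' where "finite A'" "card A' = card A" "card (A' + k *o A') = card (A + k *o A)"
    "\<exists>a\<in>A'. \<exists>b\<in>A'. \<not> [a = b] (mod q)"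
proof -
  have "\<exists>A'. finite A' \<and> card A' = card A \<and> card (A' + k *o A') = card (A + k *o A) \<and>
    (\<exists>a\<in>A'. \<exists>b\<in>A'. \<not> [a = b] (mod q))"
    using assms(2-5)
  proof (induction "nat \<bar>x - y\<bar>" arbitrary: A x y rule: less_induct)
    case less
    show ?case
    proof (cases "\<exists>a\<in>A. \<exists>b\<in>A. \<not> [a = b] (mod q)")
      case True
      then show ?thesis using less.prems by blast
    next
      case False
      let ?r = "\<lambda>z. x + q * z" and ?A = "(\<lambda>z. (z - x) div q) ` A"
      have r: "?r ((z - x) div q) = z" if "z \<in> A" for z
      proof -
        have "q dvd z - x" using False that less.prems(2) by (auto simp: cong_iff_dvd_diff)
        then show ?thesis by simp
      qed
      have A: "A = ?r ` ?A" using r by force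
      have "card A = card ?A" by (subst A, rule card_image) (use assms(1) in \<open>auto simp: inj_on_def\<close>)
      moreover have "card (A + k *o A) = card (?A + k *o ?A)"
        by (subst (1 2) A, rule card_dilate_sumset_affine) (use assms(1) in simp)
      moreover have "\<exists>A'. finite A' \<and> card A' = card ?A \<and> card (A' + k *o A') = card (?A + k *o ?A) \<and>
         (\<exists>a\<in>A'. \<exists>b\<in>A'. \<not> [a = b] (mod q))"
      proof (rule less.hyps)
        define t where "t = (y - x) div q"
        have t: "y - x = q * t" using r[OF less.prems(3)] by (simp add: t_def)
        with less.prems(4) have "t \<noteq> 0" by auto
        then have "1 * \<bar>t\<bar> < q * \<bar>t\<bar>" using assms(1) by (intro mult_strict_right_mono) auto
        also have "q * \<bar>t\<bar> = \<bar>x - y\<bar>"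
          unfolding abs_minus_commute[of x y] t using assms(1) by (simp add: abs_mult)
        finally show "nat \<bar>0 - t\<bar> < nat \<bar>x - y\<bar>" by simp
        show "0 \<noteq> t" "finite ?A" "t \<in> ?A" using \<open>t \<noteq> 0\<close> less.prems by (auto simp: t_def)
        show "0 \<in> ?A" using less.prems by force
      qed
      ultimately show ?thesis by simp
    qed
  qed
  then show ?thesis using that by blast
qed

text \<open>Each increase of the slope loses the previous constant once per residue class. If \<open>A\<close> has more
  than \<open>n\<close> classes, \<open>card_dilate_sumset_ge\<close> gives the new slope \<open>n + 2\<close> directly; otherwise there are
  at most \<open>n\<close> losses. The factorials absorb this, as \<open>n * max (fact n) (n + 1) \<le> fact (n + 1)\<close>.\<close>
lemma dilate_bound_weak:
  fixes p \<alpha> n :: nat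
  assumes p: "prime p" "k = int p ^ \<alpha>" "\<alpha> > 0"
  shows "int n \<le> k \<Longrightarrow> finite A \<Longrightarrow> A \<noteq> {} \<Longrightarrow>
    int (card (A + k *o A)) \<ge> (int n + 1) * int (card A) - fact n"
proof (induction n arbitrary: A)
  case 0
  have "card A + card (k *o A) \<le> card (A + k *o A) + 1"
    using 0 by (intro card_sumset_ge) (auto simp: dilate_eq_image)
  moreover have "card (k *o A) > 0" using 0 by (simp add: card_gt_0_iff dilate_eq_image)
  ultimately show ?case by simp
next
  case (Suc n)
  have "k > 0" using p by (simp add: prime_gt_0_nat)
  show ?case
  proof (cases "\<exists>x\<in>A. \<exists>y\<in>A. x \<noteq> y")
    case False
    then obtain a where a: "A = {a}" using Suc.prems by blast
    then have "A + k *o A = {a + k * a}" by (auto simp: set_plus_def elt_set_times_def)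
    moreover have "int (Suc n) \<le> fact (Suc n)"
      using fact_ge_self[of "Suc n"] by (metis of_nat_fact of_nat_le_iff)
    ultimately show ?thesis using a by (simp del: fact_Suc)
  next
    case True
    then obtain x y where xy: "x \<in> A" "y \<in> A" "x \<noteq> y" by blast
    have "int p > 1" using prime_gt_1_nat[OF p(1)] by simp
    then obtain A' a b where A': "finite A'" "card A' = card A" "card (A' + k *o A') = card (A + k *o A)"
      and ab: "a \<in> A'" "b \<in> A'" "\<not> [a = b] (mod (int p))"
      using normalise_mod[OF _ Suc.prems(2) xy, of "int p" k] by metis
    define j where "j = int (card (classes k A'))"
    have fact_ge: "int (Suc n) \<le> fact (Suc n)" "int n \<le> fact n"
      using fact_ge_self[of "Suc n"] fact_ge_self[of n] by (metis of_nat_fact of_nat_le_iff)+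
    have "int (card (A' + k *o A')) \<ge> (int (Suc n) + 1) * int (card A') - fact (Suc n)"
    proof (cases "j \<ge> int (Suc n)")
      case True
      have "card A' \<ge> 1" using A'(1) ab by (metis One_nat_def Suc_leI card_gt_0_iff empty_iff)
      then have "(j - int (Suc n)) * (int (card A') - 1) \<ge> 0" using True by simp
      moreover have "int (card (A' + k *o A')) \<ge> int (card A') + j * (int (card A') - 1)"
        using card_dilate_sumset_ge[of A' A' k] A' ab \<open>k > 0\<close> unfolding j_def by blast
      ultimately show ?thesis using fact_ge(1) by (simp add: algebra_simps)
    next
      case False
      define L :: int where "L = max (fact n) (int (Suc n))"
      have IH: "int (card (X + k *o X)) \<ge> int (Suc n) * int (card X) - fact n"
        if "finite X" "X \<noteq> {}" for X
        using Suc.IH[of X] Suc.prems(1) that by (simp add: algebra_simps)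
      have "int (card (A' + k *o A')) \<ge> (int (Suc n) + 1) * int (card A') - j * L"
        unfolding j_def
        by (rule dilate_bound_step[OF p A'(1) ab IH]) (use Suc.prems in \<open>auto simp: L_def\<close>)
      moreover have "j * L \<le> int n * L"
        using False by (intro mult_right_mono) (auto simp: L_def)
      moreover have "int n * L \<le> fact (Suc n)"
      proof -
        have "int n * fact n \<le> fact (Suc n)" by (simp add: algebra_simps)
        moreover have "int n * int (Suc n) \<le> fact n * int (Suc n)"
          using fact_ge(2) by (intro mult_right_mono) auto
        ultimately show ?thesis by (auto simp: L_def max_def algebra_simps)
      qed
      ultimately show ?thesis by linarith
    qed
    then show ?thesis using A' by simp
  qed
qed

section \<open>The sharp constant\<close>

text \<open>Once slope \<open>k + 1\<close> is known for all sets, a fiber that is not full produces a gain as large as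
  the largest fiber \<open>x\<close>, while only constants are lost. The gain comes from the fiber \<open>i\<close> itself if the
  largest class \<open>w\<close> differs from \<open>i\<close> mod \<open>p\<close>. Otherwise it comes from a class \<open>v\<close> incongruent to
  both: either \<open>X v\<close> is not full and gains \<open>x w\<close>, or it is full, and its surplus \<open>k * (x w - x v)\<close>
  and the gain \<open>x v\<close> of the fiber \<open>i\<close> add up to at least \<open>x w\<close>.\<close>

lemma dilate_bound_not_full:
  fixes p \<alpha> :: nat and C :: int
  assumes p: "prime p" "k = int p ^ \<alpha>" "\<alpha> > 0" and A: "finite A"
    and ab: "a \<in> A" "b \<in> A" "\<not> [a = b] (mod (int p))"
    and bound: "\<And>X. finite X \<Longrightarrow> X \<noteq> {} \<Longrightarrow> int (card (X + k *o X)) \<ge> (k + 1) * int (card X) - C"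
    and C: "k \<le> C"
    and i: "i \<in> classes k A" "\<not> full k (fiber k A i)"
  obtains x where "int (card A) \<le> int (card (classes k A)) * x"
    "int (card (A + k *o A)) \<ge> (k + 1) * int (card A) - int (card (classes k A)) * C + x"
proof -
  have "k > 0" "int p > 0" using p by (simp_all add: prime_gt_0_nat)
  have pk: "int p dvd k" using p by (simp add: dvd_power)
  define U where "U = classes k A"
  define X where "X = fiber k A"
  define x where "x = (\<lambda>u. int (card (X u)))"
  define g where "g = (\<lambda>u. int (card (X u + A)) - ((k + 1) * x u - C))"
  have finX: "finite (X u)" for u using A \<open>k > 0\<close> by (simp add: X_def)
  have x0: "x u \<ge> 0" for u by (simp add: x_def)
  have finU: "finite U" using A by (simp add: U_def)
  obtain w where w: "w \<in> U" "\<And>u. u \<in> U \<Longrightarrow> x u \<le> x w"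
    using largest_fiber[of A k] A ab(1) unfolding U_def x_def X_def
    by (metis empty_iff of_nat_le_iff)
  have F: "g u \<ge> k * (x w - x u)" if u: "u \<in> U" "full k (X u)" for u
  proof -
    have "int (card (X u + A)) \<ge> x u + k * (x w - 1)"
      using full_sumset_ge[of k "X u" A w] u w finX A \<open>k > 0\<close>
      by (simp add: x_def X_def U_def)
    then show ?thesis using C unfolding g_def by (simp add: algebra_simps)
  qed
  have E: "g u \<ge> x l" if u: "u \<in> U" "\<not> full k (X u)" and l: "\<not> [l = u] (mod (int p))" for u l
  proof -
    obtain \<beta> where \<beta>: "1 \<le> \<beta>" "\<beta> \<le> \<alpha>"
      "\<And>l. \<not> [l = u] (mod (int p ^ \<beta>)) \<Longrightarrow>
         int (card (X u + A)) \<ge> (k + 1) * x u - C + int p ^ (\<alpha> - \<beta>) * x l"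
      using fiber_gain_not_full[OF p(1,2) A bound, of u] u unfolding X_def U_def x_def by blast
    have "\<not> [l = u] (mod (int p ^ \<beta>))"
      using l cong_dvd_modulus[of l u "int p ^ \<beta>" "int p"] \<beta>(1) by (auto simp: dvd_power)
    moreover have "1 * x l \<le> int p ^ (\<alpha> - \<beta>) * x l"
      using \<open>int p > 0\<close> x0 by (intro mult_right_mono) (auto simp: one_le_power)
    ultimately show ?thesis using \<beta>(3)[of l] unfolding g_def by linarith
  qed
  have g0: "g u \<ge> 0" if "u \<in> U" for u
  proof (cases "full k (X u)")
    case True
    have "k * (x w - x u) \<ge> 0" using \<open>k > 0\<close> w(2)[OF that] by simp
    then show ?thesis using F[OF that True] by linarith
  next
    case False
    obtain l where "\<not> [l = u] (mod int p)"
      using incongruent_class[OF ab pk] by blast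
    then show ?thesis using E[OF that False, of l] x0[of l] by linarith
  qed
  have ge: "(\<Sum>u\<in>V. g u) \<le> (\<Sum>u\<in>U. g u)" if "V \<subseteq> U" for V
    using that g0 finU by (intro sum_mono2) auto
  have i: "i \<in> U" "\<not> full k (X i)" using i by (simp_all add: U_def X_def)
  have "(\<Sum>u\<in>U. g u) \<ge> x w"
  proof (cases "[w = i] (mod int p)")
    case False
    then show ?thesis using E[OF i False] ge[of "{i}"] i by simp
  next
    case True
    obtain v where v: "v \<in> U" "\<not> [v = i] (mod int p)"
      using incongruent_class[OF ab pk] unfolding U_def by blast
    show ?thesis
    proof (cases "full k (X v)")
      case False
      have "\<not> [w = v] (mod int p)" using True v(2) cong_sym cong_trans by blast
      then show ?thesis using E[OF v(1) False] ge[of "{v}"] v by fastforce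
    next
      case True
      have "v \<noteq> i" using v(2) by auto
      then have "g v + g i \<le> (\<Sum>u\<in>U. g u)" using ge[of "{v, i}"] v i by simp
      moreover have "g i \<ge> x v" using E[OF i v(2)] .
      moreover have "1 * (x w - x v) \<le> k * (x w - x v)"
        using \<open>k > 0\<close> w(2)[OF v(1)] by (intro mult_right_mono) auto
      moreover have "g v \<ge> k * (x w - x v)" using F[OF v(1) True] .
      ultimately show ?thesis unfolding mult_1 by linarith
    qed
  qed
  moreover have sx: "(\<Sum>u\<in>U. x u) = int (card A)"
    using card_eq_sum_fibers[OF A \<open>k > 0\<close>] by (simp add: U_def x_def X_def)
  moreover have "(\<Sum>u\<in>U. g u) = int (card (A + k *o A)) - (k + 1) * (\<Sum>u\<in>U. x u) + int (card U) * C"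
    using card_dilate_sumset[OF A A \<open>k > 0\<close>]
    by (simp add: g_def U_def X_def sum_subtractf sum.distrib sum_distrib_left)
  ultimately have "int (card (A + k *o A)) \<ge> (k + 1) * int (card A) - int (card U) * C + x w"
    by (simp add: algebra_simps)
  moreover have "int (card A) \<le> int (card U) * x w"
    using sum_bounded_above[of U x "x w"] w(2) sx by simp
  ultimately show ?thesis using that unfolding U_def by blast
qed

text \<open>Let \<open>n\<close> be the size of the largest fibers, \<open>M\<close> the classes that have this size, and \<open>s\<close> the
  class in \<open>M\<close> whose least element \<open>a s\<close> in \<open>A\<close> is largest. For each class \<open>u\<close>, fullness gives
  \<open>card (X u) + k * (n - 1)\<close> elements in the sum of \<open>X u\<close> with the class \<open>s\<close> of \<open>A\<close>. All of them are at
  least \<open>Min (X u) + a s\<close>, so the \<open>card M - 1\<close> elements \<open>Min (X u) + a l\<close> with \<open>l \<in> M - {s}\<close> are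
  further ones. If all \<open>j\<close> fibers have size \<open>n\<close>, the sum over \<open>u\<close> is the claim. A class outside \<open>M\<close>
  costs \<open>j\<close> of the extra elements, one for each \<open>u\<close>, but the shortfall of its fiber below \<open>n\<close> leaves a
  surplus of at least \<open>k \<ge> j\<close>.\<close>
lemma dilate_bound_all_full:
  fixes k :: int
  assumes "k > 0" and A: "finite A" "A \<noteq> {}"
    and full: "\<And>u. u \<in> classes k A \<Longrightarrow> full k (fiber k A u)"
  defines "j \<equiv> int (card (classes k A))"
  shows "int (card (A + k *o A)) \<ge> (k + 1) * int (card A) - j * (k + 1 - j)"
proof -
  define U where "U = classes k A"
  define X where "X = fiber k A"
  define x where "x = (\<lambda>u. int (card (X u)))"
  have finX: "finite (X u)" for u using A \<open>k > 0\<close> by (simp add: X_def)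
  have neX: "X u \<noteq> {}" if "u \<in> U" for u using that \<open>k > 0\<close> by (simp add: X_def U_def fiber_nonempty)
  have finU: "finite U" using A by (simp add: U_def)
  obtain w where w: "w \<in> U" "\<And>u. u \<in> U \<Longrightarrow> x u \<le> x w"
    using largest_fiber[OF A, of k] unfolding U_def x_def X_def by (metis of_nat_le_iff)
  define n where "n = x w"
  define M where "M = {u \<in> U. x u = n}"
  define a where "a = (\<lambda>u. u + k * Min (X u))"
  have aA: "a u \<in> A" if "u \<in> U" for u
    using Min_in[OF finX neX[OF that]] by (simp add: a_def X_def fiber_def)
  have M: "M \<subseteq> U" "finite M" "M \<noteq> {}" using finU w by (auto simp: M_def n_def)
  have "Max (a ` M) \<in> a ` M" using M by (intro Max_in) auto
  then obtain s where s: "s \<in> M" "a s = Max (a ` M)" by auto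
  then have xs: "x s = n" by (simp add: M_def)
  have s_max: "a l \<le> a s" if "l \<in> M" for l using that M s by simp
  have inj: "inj_on a U"
  proof (rule inj_onI)
    fix u v assume uv: "u \<in> U" "v \<in> U" "a u = a v"
    have "[u = a u] (mod k)" "[v = a v] (mod k)" by (simp_all add: a_def cong_iff_dvd_diff)
    then have "[u = v] (mod k)" using uv(3) cong_sym cong_trans by metis
    then show "u = v" using uv classes_cong_eq unfolding U_def by blast
  qed
  have piece: "int (card (X u + A)) \<ge> x u + k * (n - 1) + (int (card M) - 1)" if u: "u \<in> U" for u
  proof -
    let ?Z = "(+) s ` (X u + k *o X s)" and ?W = "(\<lambda>l. Min (X u) + a l) ` (M - {s})"
    have finZ: "finite ?Z" using finX by (simp add: finite_set_plus)
    have Zs: "?Z \<subseteq> X u + A"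
      unfolding X_def by (rule translated_fiber_sumset_subset)
    have Ws: "?W \<subseteq> X u + A"
      using aA M(1) Min_in[OF finX neX[OF u]] by auto
    have "z \<notin> ?W" if z: "z \<in> ?Z" for z
    proof
      assume "z \<in> ?W"
      then obtain l where l: "l \<in> M" "l \<noteq> s" "z = Min (X u) + a l" by auto
      obtain y t where yt: "y \<in> X u" "t \<in> X s" "z = s + (y + k * t)"
        using z by (auto simp: set_plus_def elt_set_times_def)
      have "Min (X u) \<le> y" using yt finX by simp
      moreover have "k * Min (X s) \<le> k * t"
        using yt finX \<open>k > 0\<close> by (intro mult_left_mono) auto
      moreover have "a l < a s"
        using s_max[OF l(1)] inj l s(1) M(1) by (metis inj_onD order_le_less subsetD)
      ultimately show False using l(3) yt(3) by (simp add: a_def)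
    qed
    then have "card ?Z + card ?W = card (?Z \<union> ?W)"
      using finZ M(2) by (subst card_Un_disjoint) auto
    also have "\<dots> \<le> card (X u + A)"
      using Zs Ws finX A by (intro card_mono finite_set_plus) auto
    finally have "card ?Z + card ?W \<le> card (X u + A)" .
    moreover have "card ?Z = card (X u + k *o X s)" by (simp add: card_image)
    moreover have "int (card (X u + k *o X s)) \<ge> x u + k * (n - 1)"
      using card_dilate_sumset_ge[OF finX finX neX \<open>k > 0\<close>, of s u] s(1) M(1)
        full_card_classes[of k "X u"] full[of u] u xs \<open>k > 0\<close>
      by (auto simp: U_def x_def X_def)
    moreover have "card ?W = card (M - {s})"
      using inj M(1) by (intro card_image) (auto simp: inj_on_def)
    moreover have "int (card (M - {s})) = int (card M) - 1"
      using s(1) M(2) by (metis card_Diff_singleton card_gt_0_iff empty_iff of_nat_1 of_nat_diff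
          One_nat_def Suc_leI)
    ultimately show ?thesis by linarith
  qed
  have sx: "(\<Sum>u\<in>U. x u) = int (card A)"
    using card_eq_sum_fibers[OF A(1) \<open>k > 0\<close>] by (simp add: U_def x_def X_def)
  have "(\<Sum>u\<in>U. x u + k * (n - 1) + (int (card M) - 1)) \<le> (\<Sum>u\<in>U. int (card (X u + A)))"
    using piece by (intro sum_mono)
  then have main: "int (card (A + k *o A)) \<ge> int (card A) + j * (k * (n - 1)) + j * (int (card M) - 1)"
    using card_dilate_sumset[OF A(1) A(1) \<open>k > 0\<close>]
    by (simp add: sum.distrib sx j_def flip: U_def X_def)
  have j: "j = int (card U)" by (simp add: j_def U_def)
  have "(\<Sum>u\<in>U. if u \<in> M then 0 else 1) \<le> (\<Sum>u\<in>U. n - x u)"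
    using w(2) by (intro sum_mono) (force simp: M_def n_def)
  moreover have "(\<Sum>u\<in>U. if u \<in> M then 0 else 1 :: int) = j - int (card M)"
  proof -
    have "(\<Sum>u\<in>U. if u \<in> M then 0 else 1 :: int) = (\<Sum>u\<in>U - M. 1)"
      using finU by (intro sum.mono_neutral_cong_right) auto
    also have "\<dots> = j - int (card M)"
      using M finU by (simp add: j card_Diff_subset card_mono of_nat_diff)
    finally show ?thesis .
  qed
  ultimately have D: "j * n - int (card A) \<ge> j - int (card M)"
    by (simp add: sum_subtractf sx j)
  have "j - int (card M) \<ge> 0" using M finU by (simp add: j card_mono)
  moreover have "j \<le> k" using card_classes_le[OF \<open>k > 0\<close>] by (simp add: j_def)
  ultimately have "j * (j - int (card M)) \<le> k * (j - int (card M))" by (intro mult_right_mono)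
  also have "\<dots> \<le> k * (j * n - int (card A))" using D \<open>k > 0\<close> by (intro mult_left_mono) auto
  finally show ?thesis using main by (simp add: algebra_simps)
qed

text \<open>If some fiber is not full and \<open>j < k\<close>, the largest fiber has at least
  \<open>card A / (k - 1) \<ge> (k - 1) * fact k\<close> elements. This is no less than the total loss \<open>j * fact k\<close>, so
  that the bound holds without any constant; here the hypothesis on \<open>card A\<close> is used.\<close>
lemma dilate_bound_classes:
  fixes p \<alpha> :: nat
  assumes p: "prime p" "k = int p ^ \<alpha>" "\<alpha> > 0" and A: "finite A"
    and ab: "a \<in> A" "b \<in> A" "\<not> [a = b] (mod (int p))"
    and large: "int (card A) \<ge> (k - 1)^2 * fact (nat k)"
  defines "j \<equiv> int (card (classes k A))"
  shows "int (card (A + k *o A)) \<ge> (k + 1) * int (card A) - j * (k + 1 - j)"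
proof -
  have "k > 0" using p by (simp add: prime_gt_0_nat)
  have jk: "0 \<le> j" "j \<le> k" using card_classes_le[OF \<open>k > 0\<close>] by (simp_all add: j_def)
  have ne: "A \<noteq> {}" using ab by blast
  consider "j = k" | "\<forall>u\<in>classes k A. full k (fiber k A u)"
    | i where "j < k" "i \<in> classes k A" "\<not> full k (fiber k A i)"
    using jk by force
  then show ?thesis
  proof cases
    case 1
    then show ?thesis
      using card_dilate_sumset_ge[OF A A ne \<open>k > 0\<close>] by (simp add: j_def algebra_simps)
  next
    case 2
    then show ?thesis
      using dilate_bound_all_full[OF \<open>k > 0\<close> A ne] by (simp add: j_def)
  next
    case 3
    define C :: int where "C = fact (nat k)"
    have "int (nat k) \<le> C"
      unfolding C_def using fact_ge_self[of "nat k"] by (metis of_nat_fact of_nat_le_iff)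
    then have C: "k \<le> C" using \<open>k > 0\<close> by simp
    have bound: "int (card (X + k *o X)) \<ge> (k + 1) * int (card X) - C"
      if "finite X" "X \<noteq> {}" for X
      using dilate_bound_weak[OF p _ that, of "nat k"] \<open>k > 0\<close> by (simp add: C_def)
    obtain x where x: "int (card A) \<le> j * x"
      "int (card (A + k *o A)) \<ge> (k + 1) * int (card A) - j * C + x"
      using dilate_bound_not_full[OF p A ab bound C 3(2,3)] unfolding j_def by blast
    have "k - 1 > 0" using 3(1) jk by (cases "j = 0") (use x(1) ne A in auto)
    have "x \<ge> (k - 1) * C"
    proof (rule ccontr)
      assume "\<not> ?thesis"
      then have less: "x < (k - 1) * C" by simp
      have "0 < card A" using A ne by (simp add: card_gt_0_iff)
      then have "x > 0" using x(1) jk(1) by (smt (verit) mult_nonneg_nonpos of_nat_0_less_iff)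
      have "j * x \<le> (k - 1) * x" using 3(1) \<open>x > 0\<close> by (intro mult_right_mono) auto
      also have "\<dots> < (k - 1) * ((k - 1) * C)"
        using less \<open>k - 1 > 0\<close> by (intro mult_strict_left_mono) auto
      also have "\<dots> \<le> int (card A)" using large by (simp add: C_def power2_eq_square mult.assoc)
      finally show False using x(1) by simp
    qed
    moreover have "j * C \<le> (k - 1) * C" using 3(1) C \<open>k > 0\<close> by (intro mult_right_mono) auto
    moreover have "j * (k + 1 - j) \<ge> 0" using jk by simp
    ultimately show ?thesis using x(2) by linarith
  qed
qed

text \<open>The quadratic \<open>j * (k + 1 - j)\<close> is at most \<open>(k + 1)^2 / 4\<close>, which exceeds \<open>k * (k + 2) / 4\<close> by
  only \<open>1/4\<close>; for an integer below it, this is lost in the ceiling.\<close>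
lemma class_defect_le_ceiling:
  fixes k :: nat and j :: int
  shows "j * (int k + 1 - j) \<le> \<lceil>real k * (real k + 2) / 4\<rceil>"
proof -
  have "0 \<le> (int k + 1 - 2 * j)^2" by simp
  then have "4 * (j * (int k + 1 - j)) \<le> int k * (int k + 2) + 1"
    by (simp add: power2_eq_square algebra_simps)
  then have "real_of_int (4 * (j * (int k + 1 - j))) \<le> real_of_int (int k * (int k + 2) + 1)"
    by (simp only: of_int_le_iff)
  then have "real_of_int (j * (int k + 1 - j)) - 1 < real k * (real k + 2) / 4" by simp
  then show ?thesis by (simp only: le_ceiling_iff)
qed

theorem theorem1:
  fixes p \<alpha> k :: nat and A :: "int set"
  assumes "prime p" and "\<alpha> > 0" and "k = p ^ \<alpha>"
    and "finite A" and "card A \<ge> (k - 1)^2 * fact k"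
  shows "int (card (A + int k *o A))
           \<ge> (int k + 1) * int (card A) - \<lceil>real k * (real k + 2) / 4\<rceil>"
proof -
  have k: "int k = int p ^ \<alpha>" using assms(3) by simp
  have "p \<ge> 2" using assms(1) by (rule prime_ge_2_nat)
  then have "k \<ge> 2" using assms(2,3) self_le_power[of p \<alpha>] by simp
  then have "2 \<le> (fact k :: nat)" using fact_ge_self[of k] by linarith
  moreover have "1 \<le> (k - 1)^2" using \<open>k \<ge> 2\<close> by (simp add: one_le_power)
  ultimately have "1 * 2 \<le> (k - 1)^2 * fact k" by (rule mult_le_mono[rotated])
  then have "\<not> card A \<le> Suc 0" using assms(5) by simp
  then obtain x y where xy: "x \<in> A" "y \<in> A" "x \<noteq> y"
    using card_le_Suc0_iff_eq[OF assms(4)] by blast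
  have "int p > 1" using \<open>p \<ge> 2\<close> by simp
  then obtain A' a b where A': "finite A'" "card A' = card A" "card (A' + int k *o A') = card (A + int k *o A)"
    and ab: "a \<in> A'" "b \<in> A'" "\<not> [a = b] (mod (int p))"
    using normalise_mod[OF _ assms(4) xy, of "int p" "int k"] by metis
  have "int ((k - 1)^2 * fact k) \<le> int (card A')" using assms(5) A'(2) by (simp only: of_nat_le_iff)
  then have large: "int (card A') \<ge> (int k - 1)^2 * fact (nat (int k))"
    using \<open>k \<ge> 2\<close> by (simp add: of_nat_diff)
  show ?thesis
    using dilate_bound_classes[OF assms(1) k assms(2) A'(1) ab large]
      class_defect_le_ceiling[of "int (card (classes (int k) A'))" k]
    unfolding A'(2,3) by linarith
qed

end
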